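(* Let $n\ge 1$, let $L>m>0$ be given and let $\kappa=\frac{L}{m}$. Then there exists an algorithm $\Sigma(\alpha,\gamma,m,L)$ which is globally asymptotically convergent via the circle criterion with R-convergence rate $$r(\alpha^*,\gamma^*,m,L)=\rho^*(\kappa)=\sqrt{\frac{\kappa-1}{\kappa+1}},$$ and the corresponding values of $\alpha$ and $\gamma$ are given by $$\alpha^*=\frac{2}{m\kappa},\qquad \gamma^*=\frac{1}{m(\kappa+1)}.$$ In addition, given any other algorithm $\Sigma(\alpha,\gamma,m,L)$ ($\alpha,\gamma\in\mathbb{R}$) which is globally asymptotically convergent via the circle criterion, its R-convergence rate satisfies $$r(\alpha,\gamma,m,L)\ge\rho^*(\kappa).$$
   Context: Time $t$ ranges over nonnegative integers, and $\|\cdot\|$ is the Euclidean norm on $\mathbb{R}^n$. Function class. For $L\ge m>0$, $\mathscr{F}_{m,L}$ is the class of cost functions $f(x,t)$, $x\in\mathbb{R}^n$, $t\geq 0$, of the form $f(x,t)=\tilde f(x-x^*(0)-at)$ with $\tilde f:\mathbb{R}^n\to\mathbb{R}$ twice differentiable, where $x^*(0)\in\mathbb{R}^n$, $a\in\mathbb{R}^n$ is a constant vector, $x^*(t)=x^*(0)+at$ is the (linearly varying) optimal point (minimizer) of $f(\cdot,t)$, and for every $x\in\mathbb{R}^n$ and all $t\ge0$ $$\big(m(x-x^*(t))-\nabla_xf(x,t)\big)^T\big(L(x-x^*(t))-\nabla_xf(x,t)\big)\le0.$$ Algorithm. For $\alpha,\gamma\in\mathbb{R}$, $\Sigma(\alpha,\gamma,m,L)$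 denotes the recursion $$x(t+1)=x(t)-\alpha\nabla_xf(x(t),t)+\gamma\nabla_xf(x(t-1),t-1)+x(t)-x(t-1),\quad t\ge1,$$ with initial conditions $x(0),x(1)\in\mathbb{R}^n$, applied to functions $f\in\mathscr{F}_{m,L}$. Global asymptotic convergence. $\Sigma(\alpha,\gamma,m,L)$ is globally asymptotically convergent if for every $f\in\mathscr{F}_{m,L}$ with optimal points $x^*(t)$: (1) for all $\sigma>0$ there is $\delta>0$ such that $\|x(0)-x^*(0)\|<\delta$ and $\|x(1)-x^*(1)\|<\delta$ imply $\|x(t)-x^*(t)\|<\sigma$ for $t=2,3,\dots$; (2) for any $x(0),x(1)\in\mathbb{R}^n$, $\lim_{t\to\infty}(x(t)-x^*(t))=0$. R-convergence rate. For a globally asymptotically convergent $\Sigma(\alpha,\gamma,m,L)$, $$r(\alpha,\gamma,m,L)=\sup_{x(0),x(1)\in\mathbb{R}^n,\ f\in\mathscr{F}_{m,L}}\ \limsup_{t\to\infty}\|x(t)-x^*(t)\|^{1/t},$$ where $x(t)$ is the solution of the recursion for $f$ with initial conditions $x(0),x(1)$. Circle criterion. Let $G_0(z)=\frac{\alpha z-\gamma}{(z-1)^2}$. $\Sigma(\alpha,\gamma,m,L)$ is said to be globally asymptotically convergent via the circle criterion if: (1) $1+mG_0(z)\ne0$ for $|z|\ge1$; and (2) the transfer function $$H_0(z)=[1+LG_0(z)][1+mG_0(z)]^{-1}=\frac{z^2+(L\alpha-2)z+1-L\gamma}{z^2+(m\alpha-2)z+1-m\gamma}$$ is strictly positive real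 (discrete time), i.e. all its poles lie in $|z|<1$ and $\operatorname{Re}H_0(e^{i\omega})>0$ for all real $\omega$.
   Formalization: The optimal γ* is taken as 2/(m(κ+1)) instead of the printed 1/(m(κ+1)); with the printed value, the cost (m/2)‖x‖² already gives rate at least √(κ/(κ+1)) > √((κ−1)/(κ+1)), so the claim as printed is false for all L>m>0. *)

theory Defs
  imports "HOL-Complex_Analysis.Complex_Analysis"
begin

definition grad :: "('a::real_inner \<Rightarrow> real) \<Rightarrow> 'a \<Rightarrow> 'a" where
  "grad g x = (THE D. GDERIV g x :> D)"

lemma grad_eqI: "GDERIV g x :> D \<Longrightarrow> grad g x = D"
proof -
  assume D: "GDERIV g x :> D"
  have "E = D" if "GDERIV g x :> E" for E
  proof -
    have "(\<lambda>h. h \<bullet> E) = (\<lambda>h. h \<bullet> D)"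
      by (rule has_derivative_unique[OF that[unfolded gderiv_def] D[unfolded gderiv_def]])
    then have "(E - D) \<bullet> E = (E - D) \<bullet> D"
      by (rule fun_cong)
    then have "(E - D) \<bullet> (E - D) = 0"
      by (simp add: inner_diff_right)
    then show ?thesis
      by simp
  qed
  with D show ?thesis
    unfolding grad_def by (rule the_equality)
qed

text \<open>\<open>cost_fun m L f xs\<close>: the cost \<open>f x t\<close> belongs to the class $\mathscr{F}_{m,L}$ and \<open>xs t\<close> is
  its optimal point at time \<open>t\<close>.  For \<open>0 < m \<le> L\<close> the sector condition makes the minimizer
  unique, so \<open>xs\<close> is determined by \<open>f\<close>.\<close>

definition cost_fun ::
  "real \<Rightarrow> real \<Rightarrow> (real ^ 'n \<Rightarrow> nat \<Rightarrow> real) \<Rightarrow> (nat \<Rightarrow> real ^ 'n) \<Rightarrow> bool" where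
  "cost_fun m L f xs \<longleftrightarrow>
     (\<exists>a. \<forall>t. xs t = xs 0 + real t *\<^sub>R a) \<and>
     (\<exists>ftilde. (\<forall>x t. f x t = ftilde (x - xs t)) \<and>
        (\<forall>x. ftilde differentiable (at x)) \<and> (\<forall>x. grad ftilde differentiable (at x))) \<and>
     (\<forall>t x. f (xs t) t \<le> f x t) \<and>
     (\<forall>t x. (m *\<^sub>R (x - xs t) - grad (\<lambda>y. f y t) x) \<bullet>
            (L *\<^sub>R (x - xs t) - grad (\<lambda>y. f y t) x) \<le> 0)"

fun iterates ::
  "real \<Rightarrow> real \<Rightarrow> (real ^ 'n \<Rightarrow> nat \<Rightarrow> real) \<Rightarrow> real ^ 'n \<Rightarrow> real ^ 'n \<Rightarrow> nat \<Rightarrow> real ^ 'n" where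
  "iterates \<alpha> \<gamma> f x0 x1 0 = x0"
| "iterates \<alpha> \<gamma> f x0 x1 (Suc 0) = x1"
| "iterates \<alpha> \<gamma> f x0 x1 (Suc (Suc t)) =
     iterates \<alpha> \<gamma> f x0 x1 (Suc t)
     - \<alpha> *\<^sub>R grad (\<lambda>y. f y (Suc t)) (iterates \<alpha> \<gamma> f x0 x1 (Suc t))
     + \<gamma> *\<^sub>R grad (\<lambda>y. f y t) (iterates \<alpha> \<gamma> f x0 x1 t)
     + iterates \<alpha> \<gamma> f x0 x1 (Suc t) - iterates \<alpha> \<gamma> f x0 x1 t"

text \<open>The \<open>itself\<close> argument carries the dimension: the costs live on \<open>real ^ 'n\<close>.\<close>

definition globally_asymptotically_convergent ::
  "'n::finite itself \<Rightarrow> real \<Rightarrow> real \<Rightarrow> real \<Rightarrow> real \<Rightarrow> bool" where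
  "globally_asymptotically_convergent _ \<alpha> \<gamma> m L \<longleftrightarrow>
     (\<forall>(f :: real ^ 'n \<Rightarrow> nat \<Rightarrow> real) xs. cost_fun m L f xs \<longrightarrow>
        (\<forall>\<sigma>>0. \<exists>\<delta>>0. \<forall>x0 x1. norm (x0 - xs 0) < \<delta> \<and> norm (x1 - xs 1) < \<delta> \<longrightarrow>
           (\<forall>t\<ge>2. norm (iterates \<alpha> \<gamma> f x0 x1 t - xs t) < \<sigma>)) \<and>
        (\<forall>x0 x1. (\<lambda>t. iterates \<alpha> \<gamma> f x0 x1 t - xs t) \<longlonglongrightarrow> 0))"

definition convergence_rate ::
  "'n::finite itself \<Rightarrow> real \<Rightarrow> real \<Rightarrow> real \<Rightarrow> real \<Rightarrow> ereal" where
  "convergence_rate _ \<alpha> \<gamma> m L =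
     Sup {limsup (\<lambda>t. ereal (root t (norm (iterates \<alpha> \<gamma> f x0 x1 t - xs t)))) |
            (f :: real ^ 'n \<Rightarrow> nat \<Rightarrow> real) xs x0 x1. cost_fun m L f xs}"

text \<open>The value \<open>G0 \<alpha> \<gamma> 1 = 0\<close> caused by division by zero is harmless in the condition
  \<open>1 + m * G0 \<alpha> \<gamma> z \<noteq> 0\<close>: at \<open>z = 1\<close> the rational function $G_0$ has a pole
  or vanishes identically.\<close>

definition G0 :: "real \<Rightarrow> real \<Rightarrow> complex \<Rightarrow> complex" where
  "G0 \<alpha> \<gamma> z = (of_real \<alpha> * z - of_real \<gamma>) / (z - 1)\<^sup>2"

definition H0 :: "real \<Rightarrow> real \<Rightarrow> real \<Rightarrow> real \<Rightarrow> complex \<Rightarrow> complex" where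
  "H0 \<alpha> \<gamma> m L z = (1 + of_real L * G0 \<alpha> \<gamma> z) / (1 + of_real m * G0 \<alpha> \<gamma> z)"

lemma H0_eq:
  assumes "z \<noteq> 1"
  shows "H0 \<alpha> \<gamma> m L z =
    (z\<^sup>2 + of_real (L * \<alpha> - 2) * z + of_real (1 - L * \<gamma>)) /
    (z\<^sup>2 + of_real (m * \<alpha> - 2) * z + of_real (1 - m * \<gamma>))"
proof -
  have nz: "(z - 1)\<^sup>2 \<noteq> 0"
    using assms by simp
  have *: "1 + of_real k * G0 \<alpha> \<gamma> z =
      (z\<^sup>2 + of_real (k * \<alpha> - 2) * z + of_real (1 - k * \<gamma>)) / (z - 1)\<^sup>2" for k
  proof -
    have "z\<^sup>2 + of_real (k * \<alpha> - 2) * z + of_real (1 - k * \<gamma>) =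
        (z - 1)\<^sup>2 + of_real k * (of_real \<alpha> * z - of_real \<gamma>)"
      by (simp add: power2_eq_square algebra_simps)
    then show ?thesis
      by (simp only: G0_def add_divide_distrib times_divide_eq_right divide_self[OF nz])
  qed
  show ?thesis
    unfolding H0_def * using nz by simp
qed

text \<open>Strict positive realness is a property of a rational function, not of its values at isolated
  points where an expression for it happens to be of the form \<open>0 / 0\<close> or to involve a division
  by zero; hence \<open>is_pole\<close> and \<open>remove_sings\<close>.\<close>

definition strictly_positive_real :: "(complex \<Rightarrow> complex) \<Rightarrow> bool" where
  "strictly_positive_real H \<longleftrightarrow>
     (\<forall>z. is_pole H z \<longrightarrow> norm z < 1) \<and> (\<forall>\<omega>::real. Re (remove_sings H (exp (\<i> * of_real \<omega>))) > 0)"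

definition convergent_via_circle_criterion ::
  "real \<Rightarrow> real \<Rightarrow> real \<Rightarrow> real \<Rightarrow> bool" where
  "convergent_via_circle_criterion \<alpha> \<gamma> m L \<longleftrightarrow>
     (\<forall>z. norm z \<ge> 1 \<longrightarrow> 1 + of_real m * G0 \<alpha> \<gamma> z \<noteq> 0) \<and>
     strictly_positive_real (H0 \<alpha> \<gamma> m L)"

text \<open>The optimal parameters are $\alpha = 2/(m\kappa)$ and $\gamma = 2/(m(\kappa+1))$.  The source
  prints $\gamma = 1/(m(\kappa+1))$, which is a misprint: for every \<open>n\<close> the costs
  $\frac m2 \|x\|^2$ and $\frac L2 \|x\|^2$ force the rate to be at least
  $\sqrt{\max(|1-m\gamma|, |1-L\gamma|)}$, which is at most $\sqrt{(\kappa-1)/(\kappa+1)}$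
  only for $\gamma = 2/(m(\kappa+1))$; the printed value gives at least
  $\sqrt{\kappa/(\kappa+1)}$.\<close>

end

theory Submission
  imports Defs
begin

text \<open>Put \<open>q = (\<kappa> - 1) / (\<kappa> + 1)\<close>.  Along the cost \<open>k/2 \<parallel>x\<parallel>\<^sup>2\<close> the
  Casoratian of two solutions is multiplied by \<open>1 - k\<gamma>\<close> in every step, so the rate is at least
  \<open>sqrt \<bar>1 - k\<gamma>\<bar>\<close>; since \<open>L (1 - m\<gamma>) - m (1 - L\<gamma>) = L - m\<close>, one of \<open>k = m\<close> and
  \<open>k = L\<close> gives at least \<open>sqrt q\<close>, for any algorithm whatsoever.

  For the optimal parameters put \<open>e = x - x\<^sup>*\<close> and \<open>y = L e - \<nabla>f\<close>.  The recursion becomes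
  \<open>e' = p + \<alpha> y\<close>, \<open>p' = q e - \<gamma> y\<close>, and with \<open>B = \<alpha> q / \<gamma>\<close> the positive definite form
  \<open>V = q \<parallel>e\<parallel>\<^sup>2 + 2 B (e \<bullet> p) + \<parallel>p\<parallel>\<^sup>2\<close> satisfies
  \<open>V' = q V - (\<gamma>\<^sup>2 - q \<alpha>\<^sup>2) (y \<bullet> ((L - m) e - y))\<close>, where the last inner product is
  nonnegative by the sector condition.  Hence \<open>\<parallel>e\<parallel>\<close> decays like \<open>(sqrt q)\<^sup>t\<close>.\<close>

section \<open>Lower bound from quadratic costs\<close>

text \<open>The Casoratian of \<open>x\<close> and \<open>y\<close> is multiplied by
  \<open>q\<close> in every step, while the bounds on \<open>x\<close> and \<open>y\<close> force it
  below a multiple of \<open>(r\<^sup>2) ^ t\<close>. Working with it avoids a case distinction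
  between real, double and complex characteristic roots.\<close>

lemma casoratian_growth:
  fixes x y :: "nat \<Rightarrow> real"
  assumes x: "\<And>t. x (Suc (Suc t)) = p * x (Suc t) - q * x t"
    and y: "\<And>t. y (Suc (Suc t)) = p * y (Suc t) - q * y t"
    and W0: "x 0 * y 1 - x 1 * y 0 \<noteq> 0"
    and "0 < r"
    and bx: "\<forall>\<^sub>F t in sequentially. \<bar>x t\<bar> \<le> r ^ t"
    and by': "\<forall>\<^sub>F t in sequentially. \<bar>y t\<bar> \<le> r ^ t"
  shows "\<bar>q\<bar> \<le> r\<^sup>2"
proof (rule ccontr)
  assume neg: "\<not> \<bar>q\<bar> \<le> r\<^sup>2"
  define W where "W t = x t * y (Suc t) - x (Suc t) * y t" for t
  have "W (Suc t) = q * W t" for t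
    unfolding W_def x y by (simp add: algebra_simps)
  then have W: "W t = q ^ t * W 0" for t
    by (induction t) auto
  have "\<bar>W 0\<bar> > 0"
    using W0 by (simp add: W_def)
  have "\<bar>q\<bar> / r\<^sup>2 > 1"
    using neg \<open>0 < r\<close> by simp
  then have "filterlim (\<lambda>t. (\<bar>q\<bar> / r\<^sup>2) ^ t) at_top sequentially"
    using filterlim_realpow_sequentially_gt1[of "\<bar>q\<bar> / r\<^sup>2"]
    by (simp add: filterlim_at_infinity_conv_norm_at_top norm_power)
  then have ev: "\<forall>\<^sub>F t in sequentially. (\<bar>q\<bar> / r\<^sup>2) ^ t > 2 * r / \<bar>W 0\<bar>"
    by (simp add: filterlim_at_top_dense)
  \<comment> \<open>\<open>W t\<close> involves both sequences at \<open>t\<close> and at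
    \<open>Suc t\<close>, hence the shifted copies of the two bounds.\<close>
  have "\<forall>\<^sub>F t in sequentially. False"
    using ev bx by' eventually_sequentially_Suc[THEN iffD2, OF bx]
      eventually_sequentially_Suc[THEN iffD2, OF by']
  proof eventually_elim
    case (elim t)
    have "\<bar>q\<bar> ^ t * \<bar>W 0\<bar> = \<bar>W t\<bar>"
      by (simp add: W[of t] abs_mult power_abs)
    also have "\<dots> \<le> \<bar>x t\<bar> * \<bar>y (Suc t)\<bar> + \<bar>x (Suc t)\<bar> * \<bar>y t\<bar>"
      unfolding W_def by (metis abs_mult abs_triangle_ineq4)
    also have "\<dots> \<le> r ^ t * r ^ Suc t + r ^ Suc t * r ^ t"
      by (intro add_mono mult_mono elim) (use \<open>0 < r\<close> in auto)
    also have "\<dots> = 2 * r * (r\<^sup>2) ^ t"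
      by (simp add: power2_eq_square power_mult_distrib)
    finally have "(\<bar>q\<bar> / r\<^sup>2) ^ t \<le> 2 * r / \<bar>W 0\<bar>"
      using \<open>\<bar>W 0\<bar> > 0\<close> \<open>0 < r\<close> by (simp add: power_divide field_simps)
    with elim(1) show False by simp
  qed
  then show False by simp
qed

lemma grad_quadratic: "grad (\<lambda>y::'a::real_inner. k / 2 * (y \<bullet> y)) x = k *\<^sub>R x"
  by (rule grad_eqI)
    (auto simp: gderiv_def inner_commute algebra_simps intro!: derivative_eq_intros)

text \<open>The gradient is \<open>k *\<^sub>R x\<close>, so the sector product is
  \<open>(m - k) * (L - k)\<close> times the squared norm. The optimal point rests at the origin,
  which is linear variation with velocity 0.\<close>

lemma cost_fun_quadratic:
  assumes "0 \<le> k" "m \<le> k" "k \<le> L"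
  shows "cost_fun m L (\<lambda>(x::real ^ 'n) t. k / 2 * (x \<bullet> x)) (\<lambda>t. 0)"
proof -
  have "(m *\<^sub>R x - k *\<^sub>R x) \<bullet> (L *\<^sub>R x - k *\<^sub>R x) \<le> 0" for x :: "real ^ 'n"
  proof -
    have "(m *\<^sub>R x - k *\<^sub>R x) \<bullet> (L *\<^sub>R x - k *\<^sub>R x) = ((m - k) * (L - k)) * (x \<bullet> x)"
      by (simp add: algebra_simps)
    also have "\<dots> \<le> 0"
      using assms by (intro mult_nonpos_nonneg) (auto intro: mult_nonpos_nonneg)
    finally show ?thesis .
  qed
  moreover have "(\<lambda>y::real ^ 'n. k / 2 * (y \<bullet> y)) differentiable (at x)" for x
    by (auto intro!: derivative_intros)
  moreover have "grad (\<lambda>y::real ^ 'n. k / 2 * (y \<bullet> y)) differentiable (at x)" for x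
    unfolding grad_quadratic by (intro derivative_intros)
  ultimately show ?thesis
    unfolding cost_fun_def using assms
    by (intro conjI exI[of _ 0] exI[of _ "\<lambda>y. k / 2 * (y \<bullet> y)"])
      (auto simp: grad_quadratic simp del: times_divide_eq_left)
qed

text \<open>On this cost every coordinate obeys a scalar linear recursion whose characteristic roots
  have product \<open>1 - k * \<gamma>\<close>, so some solution cannot decay faster than the square
  root of its modulus.\<close>

lemma convergence_rate_ge_quadratic:
  assumes "0 \<le> k" "m \<le> k" "k \<le> L"
  shows "ereal (sqrt \<bar>1 - k * \<gamma>\<bar>) \<le> convergence_rate TYPE('n::finite) \<alpha> \<gamma> m L"
proof (rule ccontr)
  assume "\<not> ?thesis"
  moreover define S where "S = convergence_rate TYPE('n) \<alpha> \<gamma> m L"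
  ultimately have S: "S < ereal (sqrt \<bar>1 - k * \<gamma>\<bar>)"
    by simp
  define f where "f = (\<lambda>(x::real ^ 'n) (t::nat). k / 2 * (x \<bullet> x))"
  \<comment> \<open>Here \<open>1\<close> is the all-ones vector, so in each coordinate the
    Casoratian of \<open>X\<close> and \<open>Y\<close> starts at 1.\<close>
  define X where "X = iterates \<alpha> \<gamma> f 1 0"
  define Y where "Y = iterates \<alpha> \<gamma> f 0 1"
  have le: "limsup (\<lambda>t. ereal (root t (norm (iterates \<alpha> \<gamma> f x0 x1 t)))) \<le> S" for x0 x1
    unfolding S_def convergence_rate_def
    by (rule Sup_upper, rule CollectI, rule exI[of _ f], rule exI[of _ "\<lambda>t. 0"])
      (use cost_fun_quadratic[OF assms] in \<open>auto simp: f_def\<close>)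
  have "0 \<le> limsup (\<lambda>t. ereal (root t (norm (X t))))"
    by (rule order_trans[OF _ Liminf_le_Limsup[of sequentially]])
      (auto intro!: Liminf_bounded always_eventually real_root_ge_zero)
  with le[of 1 0] have "0 \<le> S"
    by (simp add: X_def)
  \<comment> \<open>The strict gap above \<open>S\<close> is what turns a bound on the limsup into
    an eventual bound by \<open>r ^ t\<close>.\<close>
  from S obtain r where r: "S < ereal r" "ereal r < ereal (sqrt \<bar>1 - k * \<gamma>\<bar>)"
    using ereal_dense2 by blast
  then have "0 < r"
    using \<open>0 \<le> S\<close> by (metis ereal_less(2) order_le_less_trans)
  have ev: "\<forall>\<^sub>F t in sequentially. \<bar>iterates \<alpha> \<gamma> f x0 x1 t $ i\<bar> \<le> r ^ t" for x0 x1 and i :: 'n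
  proof -
    have "\<forall>\<^sub>F t in sequentially. ereal (root t (norm (iterates \<alpha> \<gamma> f x0 x1 t))) < ereal r"
      by (rule Limsup_lessD) (use le r in \<open>auto intro: order_le_less_trans\<close>)
    then show ?thesis
      \<comment> \<open>At \<open>t = 0\<close> the value of \<open>root\<close> is 0 by convention,
        and taking the power does not undo it.\<close>
      using eventually_gt_at_top[of 0]
    proof eventually_elim
      case (elim t)
      have "norm (iterates \<alpha> \<gamma> f x0 x1 t) = root t (norm (iterates \<alpha> \<gamma> f x0 x1 t)) ^ t"
        using elim by simp
      also have "\<dots> \<le> r ^ t"
        using elim by (intro power_mono) auto
      finally show ?case
        using component_le_norm_cart order_trans by blast
    qed
  qed
  have rec: "iterates \<alpha> \<gamma> f x0 x1 (Suc (Suc t)) $ i =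
      (2 - k * \<alpha>) * iterates \<alpha> \<gamma> f x0 x1 (Suc t) $ i - (1 - k * \<gamma>) * iterates \<alpha> \<gamma> f x0 x1 t $ i"
    for x0 x1 t and i :: 'n
    unfolding iterates.simps f_def grad_quadratic by (simp add: algebra_simps)
  \<comment> \<open>Any coordinate will do; one exists because types are inhabited.\<close>
  fix i :: 'n
  have "\<bar>1 - k * \<gamma>\<bar> \<le> r\<^sup>2"
    by (rule casoratian_growth[of "\<lambda>t. X t $ i" "2 - k * \<alpha>" _ "\<lambda>t. Y t $ i"])
      (use \<open>0 < r\<close> in \<open>auto simp: X_def Y_def ev rec simp del: iterates.simps(3)\<close>)
  then have "sqrt \<bar>1 - k * \<gamma>\<bar> \<le> r"
    using \<open>0 < r\<close> by (simp add: real_le_lsqrt)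
  with r show False by simp
qed

lemma convergence_rate_ge:
  assumes "0 < m" "m < L"
  shows "ereal (sqrt ((L - m) / (L + m))) \<le> convergence_rate TYPE('n::finite) \<alpha> \<gamma> m L"
proof -
  define q where "q = (L - m) / (L + m)"
  have "q \<le> \<bar>1 - m * \<gamma>\<bar> \<or> q \<le> \<bar>1 - L * \<gamma>\<bar>"
  proof (rule ccontr)
    assume "\<not> ?thesis"
    \<comment> \<open>With the weights \<open>L\<close> and \<open>m\<close> the left sides add up
      to \<open>L - m\<close>, free of \<gamma>, and the right sides to \<open>(L + m) * q\<close>,
      which is \<open>L - m\<close> as well.\<close>
    then have "L * (1 - m * \<gamma>) < L * q" "m * (L * \<gamma> - 1) < m * q"
      using assms by auto
    then have "L - m < (L + m) * q"
      by (simp add: algebra_simps)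
    then show False
      using assms by (simp add: q_def)
  qed
  then show ?thesis
  proof
    assume "q \<le> \<bar>1 - m * \<gamma>\<bar>"
    then have "ereal (sqrt q) \<le> ereal (sqrt \<bar>1 - m * \<gamma>\<bar>)"
      by simp
    also have "\<dots> \<le> convergence_rate TYPE('n) \<alpha> \<gamma> m L"
      using assms by (intro convergence_rate_ge_quadratic) auto
    finally show ?thesis by (simp add: q_def)
  next
    assume "q \<le> \<bar>1 - L * \<gamma>\<bar>"
    then have "ereal (sqrt q) \<le> ereal (sqrt \<bar>1 - L * \<gamma>\<bar>)"
      by simp
    also have "\<dots> \<le> convergence_rate TYPE('n) \<alpha> \<gamma> m L"
      using assms by (intro convergence_rate_ge_quadratic) auto
    finally show ?thesis by (simp add: q_def)
  qed
qed

section \<open>The circle criterion\<close>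

text \<open>Outside the open unit disc \<open>D\<close> has no zero, so \<open>H0\<close> has the
  finite limit \<open>N z / D z\<close> there, also at \<open>z = 1\<close>. This excludes poles and
  gives the value of \<open>remove_sings\<close>; on the circle \<open>N / D\<close> and
  \<open>N * cnj D\<close> have real parts of the same sign.\<close>

lemma convergent_via_circle_criterionI:
  fixes \<alpha> \<gamma> m L :: real
  defines "N \<equiv> \<lambda>z. z\<^sup>2 + complex_of_real (L * \<alpha> - 2) * z + of_real (1 - L * \<gamma>)"
    and "D \<equiv> \<lambda>z. z\<^sup>2 + complex_of_real (m * \<alpha> - 2) * z + of_real (1 - m * \<gamma>)"
  assumes D: "\<And>z. norm z \<ge> 1 \<Longrightarrow> D z \<noteq> 0"
    and pos: "\<And>z. norm z = 1 \<Longrightarrow> Re (N z * cnj (D z)) > 0"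
  shows "convergent_via_circle_criterion \<alpha> \<gamma> m L"
proof -
  have lim: "(H0 \<alpha> \<gamma> m L \<longlongrightarrow> N z / D z) (at z)" if "norm z \<ge> 1" for z
  proof -
    have "((\<lambda>w. N w / D w) \<longlongrightarrow> N z / D z) (at z)"
      using D[OF that] unfolding N_def D_def by (intro tendsto_intros) auto
    moreover have "\<forall>\<^sub>F w in at z. N w / D w = H0 \<alpha> \<gamma> m L w"
    proof -
      have "\<forall>\<^sub>F w in at z. w \<noteq> 1"
        by (rule eventually_neq_at_within)
      then show ?thesis
        by eventually_elim (simp add: H0_eq N_def D_def)
    qed
    ultimately show ?thesis
      by (rule Lim_transform_eventually)
  qed
  have "1 + of_real m * G0 \<alpha> \<gamma> z \<noteq> 0" if "norm z \<ge> 1" for z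
  \<comment> \<open>At 1 the division by zero makes \<open>G0\<close> vanish and the expression
    equal to 1; elsewhere, multiplying by \<open>(z - 1)\<^sup>2\<close> gives
    \<open>D z\<close>.\<close>
  proof (cases "z = 1")
    case True
    then show ?thesis by (simp add: G0_def)
  next
    case False
    then have "G0 \<alpha> \<gamma> z * (z - 1)\<^sup>2 = of_real \<alpha> * z - of_real \<gamma>"
      by (simp add: G0_def)
    then have "(1 + of_real m * G0 \<alpha> \<gamma> z) * (z - 1)\<^sup>2 =
        (z - 1)\<^sup>2 + of_real m * (of_real \<alpha> * z - of_real \<gamma>)"
      by (simp add: distrib_right mult.assoc)
    also have "\<dots> = D z"
      by (simp add: D_def power2_eq_square algebra_simps)
    finally have "(1 + of_real m * G0 \<alpha> \<gamma> z) * (z - 1)\<^sup>2 = D z" .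
    with D[OF that] show ?thesis by auto
  qed
  moreover have "norm z < 1" if "is_pole (H0 \<alpha> \<gamma> m L) z" for z
    using lim[of z] that not_tendsto_and_filterlim_at_infinity[of "at z"]
    unfolding is_pole_def by force
  moreover have "Re (remove_sings (H0 \<alpha> \<gamma> m L) (exp (\<i> * of_real \<omega>))) > 0" for \<omega>
  proof -
    define z where "z = exp (\<i> * complex_of_real \<omega>)"
    have z: "norm z = 1"
      by (simp add: z_def)
    then have "remove_sings (H0 \<alpha> \<gamma> m L) z = N z / D z"
      by (intro remove_sings_eqI lim) simp
    also have "Re \<dots> = Re (N z * cnj (D z)) / (norm (D z))\<^sup>2"
      by (subst complex_div_cnj) (simp add: Re_divide_of_real flip: of_real_power)
    also have "\<dots> > 0"
      using pos[OF z] D[of z] z by simp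
    finally show ?thesis by (simp add: z_def)
  qed
  ultimately show ?thesis
    unfolding convergent_via_circle_criterion_def strictly_positive_real_def by blast
qed

text \<open>Since \<open>b\<^sup>2 \<le> q\<close>, the roots are complex conjugate or coincide, so
  their squared modulus is their product \<open>q\<close>.\<close>

lemma quadratic_roots_in_disc:
  fixes z :: complex
  assumes "b\<^sup>2 \<le> q" "q < 1" "norm z \<ge> 1"
  shows "z\<^sup>2 - of_real (2 * b) * z + of_real q \<noteq> 0"
proof
  assume 0: "z\<^sup>2 - of_real (2 * b) * z + of_real q = 0"
  define x y where "x = Re z" and "y = Im z"
  have re: "x\<^sup>2 - y\<^sup>2 - 2 * b * x + q = 0" and im: "2 * (x - b) * y = 0"
    using arg_cong[OF 0, of Re] arg_cong[OF 0, of Im]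
    by (simp_all add: x_def y_def power2_eq_square algebra_simps)
  have n: "x\<^sup>2 + y\<^sup>2 \<ge> 1"
    using assms(3) by (simp add: x_def y_def cmod_def)
  from im consider "y = 0" | "x = b" by auto
  then show False
  proof cases
    case 1
    have "(x - b)\<^sup>2 = b\<^sup>2 - q"
      using re 1 by (simp add: power2_eq_square algebra_simps)
    then have "x = b"
      using assms(1) by (smt (verit) zero_le_power2 power2_eq_iff_nonneg zero_eq_power2)
    then show False
      using 1 n assms by simp
  next
    case 2
    then show False
      using re n assms by (simp add: power2_eq_square algebra_simps)
  qed
qed

lemma optimal_parameters_circle_criterion:
  assumes "0 < m" "m < L"
  shows "convergent_via_circle_criterion (2 / L) (2 / (L + m)) m L"
proof -
  define q b where "q = (L - m) / (L + m)" and "b = 1 - m / L"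
  have q: "0 < q" "q < 1" and b: "b \<ge> 0"
    using assms by (auto simp: q_def b_def field_simps)
  \<comment> \<open>As \<open>b = (L - m) / L\<close>, this amounts to
    \<open>(L - m) * (L + m) \<le> L\<^sup>2\<close>.\<close>
  have bq: "b\<^sup>2 \<le> q"
  proof -
    have "(L - m)\<^sup>2 * (L + m) = (L - m) * (L\<^sup>2 - m\<^sup>2)"
      by (simp add: power2_eq_square algebra_simps)
    also have "\<dots> \<le> (L - m) * L\<^sup>2"
      using assms by (intro mult_left_mono) auto
    finally have "(L - m)\<^sup>2 / L\<^sup>2 \<le> (L - m) / (L + m)"
      using assms by (simp add: field_simps)
    moreover have "b = (L - m) / L"
      using assms by (simp add: b_def field_simps)
    ultimately show ?thesis
      by (simp add: q_def power_divide)
  qed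
  have coeffs: "L * (2 / L) - 2 = 0" "1 - L * (2 / (L + m)) = - q"
      "m * (2 / L) - 2 = - (2 * b)" "1 - m * (2 / (L + m)) = q"
    using assms by (auto simp: q_def b_def field_simps)
  have pos: "Re ((z\<^sup>2 - of_real q) * cnj (z\<^sup>2 - of_real (2 * b) * z + of_real q)) > 0"
    if "norm z = 1" for z
  proof -
    define x y where "x = Re z" and "y = Im z"
    have n: "y\<^sup>2 = 1 - x\<^sup>2"
      using that by (simp add: x_def y_def cmod_def)
    have "x \<le> 1"
      using n by (metis abs_le_square_iff abs_one diff_ge_0_iff_ge one_power2 zero_le_power2 abs_le_D1)
    define N D where "N = z\<^sup>2 - of_real q" and "D = z\<^sup>2 - of_real (2 * b) * z + of_real q"
    have N: "Re N = 2 * x\<^sup>2 - 1 - q" "Im N = 2 * x * y"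
      and D: "Re D = 2 * x\<^sup>2 - 1 - 2 * b * x + q" "Im D = 2 * x * y - 2 * b * y"
      using n by (simp_all add: N_def D_def x_def y_def Re_power2 Im_power2)
    have "Re (N * cnj D) = Re N * Re D + Im N * Im D"
      by simp
    also have "\<dots> = (2 * x\<^sup>2 - 1 - q) * (2 * x\<^sup>2 - 1 - 2 * b * x + q) + (4 * x\<^sup>2 - 4 * b * x) * y\<^sup>2"
      unfolding N D by (simp add: power2_eq_square algebra_simps)
    \<comment> \<open>On the unit circle all higher powers of \<open>x\<close> cancel; what remains
      is affine in \<open>x\<close> and smallest at \<open>x = 1\<close>.\<close>
    also have "\<dots> = (1 - q) * (1 + q - 2 * b * x)"
      unfolding n by (simp add: power2_eq_square algebra_simps)
    also have "\<dots> > 0"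
    proof -
      have "b < 1" using assms by (simp add: b_def)
      have "0 < (1 - b)\<^sup>2" using \<open>b < 1\<close> by simp
      then have "2 * b < 1 + q"
        using bq by (simp add: power2_eq_square algebra_simps)
      moreover have "b * x \<le> b"
        using b \<open>x \<le> 1\<close> by (simp add: mult_left_le)
      ultimately show ?thesis
        using q by (intro mult_pos_pos) auto
    qed
    finally show ?thesis by (simp only: N_def D_def)
  qed
  show ?thesis
    by (rule convergent_via_circle_criterionI; unfold coeffs)
      (use quadratic_roots_in_disc[OF bq q(2)] pos in \<open>simp_all\<close>)
qed

section \<open>Upper bound from a quadratic Lyapunov function\<close>

text \<open>The cross coefficient \<open>\<alpha> * q / \<gamma>\<close> is chosen so that the terms
  in \<open>p \<bullet> y\<close> cancel; the other terms containing \<open>y\<close> then combine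
  into a single product of sector type.\<close>

lemma lyapunov_identity:
  fixes e p y :: "'a::real_inner" and q \<alpha> \<gamma> :: real
  assumes "\<gamma> \<noteq> 0"
  defines "V \<equiv> \<lambda>e p. q * (e \<bullet> e) + 2 * (\<alpha> * q / \<gamma>) * (e \<bullet> p) + p \<bullet> p"
  shows "V (p + \<alpha> *\<^sub>R y) (q *\<^sub>R e - \<gamma> *\<^sub>R y) =
    q * V e p - (\<gamma>\<^sup>2 - q * \<alpha>\<^sup>2) * (y \<bullet> ((2 * q / \<gamma>) *\<^sub>R e - y))"
proof -
  have "p \<bullet> e = e \<bullet> p" "y \<bullet> e = e \<bullet> y" "y \<bullet> p = p \<bullet> y"
    by (rule inner_commute)+
  then show ?thesis
    using assms(1) unfolding V_def
    by (simp add: inner_add_left inner_add_right inner_diff_left inner_diff_right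
        field_simps power2_eq_square)
qed

text \<open>\<open>V\<close> contracts by the factor \<open>\<rho>\<^sup>2\<close> per step and
  dominates a multiple of the squared error. \<open>C\<close> is uniform in the cost and the initial
  points, so the same bound yields stability, attraction and the rate.\<close>

lemma optimal_parameters_decay:
  fixes m L :: real
  assumes "0 < m" "m < L"
  defines "\<alpha> \<equiv> 2 / L" and "\<gamma> \<equiv> 2 / (L + m)" and "\<rho> \<equiv> sqrt ((L - m) / (L + m))"
  obtains C where "C > 0"
    "\<And>(f :: real ^ 'n \<Rightarrow> nat \<Rightarrow> real) xs x0 x1 t. cost_fun m L f xs \<Longrightarrow>
       norm (iterates \<alpha> \<gamma> f x0 x1 t - xs t) \<le> C * (norm (x0 - xs 0) + norm (x1 - xs 1)) * \<rho> ^ t"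
proof -
  define q where "q = (L - m) / (L + m)"
  define B where "B = \<alpha> * q / \<gamma>"
  have q: "0 < q" "q < 1" and pos: "\<alpha> > 0" "\<gamma> > 0"
    using assms(1,2) by (auto simp: q_def \<alpha>_def \<gamma>_def)
  have rho: "\<rho> > 0" "\<rho>\<^sup>2 = q"
    using q by (auto simp: \<rho>_def q_def)
  \<comment> \<open>The resulting positivity of
    \<open>\<gamma>\<^sup>2 - q * \<alpha>\<^sup>2\<close> is used twice: it gives the sector term
    the right sign, and it yields \<open>B\<^sup>2 < q\<close>, which makes \<open>V\<close>
    positive definite.\<close>
  have "\<alpha>\<^sup>2 * q = \<gamma>\<^sup>2 * (1 - m\<^sup>2 / L\<^sup>2)"
    using assms(1,2) by (simp add: \<alpha>_def \<gamma>_def q_def divide_simps) (simp add: power2_eq_square algebra_simps)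
  moreover have "\<gamma>\<^sup>2 * (1 - m\<^sup>2 / L\<^sup>2) < \<gamma>\<^sup>2 * 1"
    using assms(1,2) pos by (intro mult_strict_left_mono) auto
  ultimately have lam: "\<gamma>\<^sup>2 - q * \<alpha>\<^sup>2 > 0"
    by (simp add: mult.commute)
  define c where "c = q - B\<^sup>2"
  have "B\<^sup>2 = q * (q * \<alpha>\<^sup>2) / \<gamma>\<^sup>2"
    by (simp add: B_def power2_eq_square)
  also have "\<dots> < q"
    using lam q pos by (simp add: field_simps)
  finally have c: "c > 0"
    by (simp add: c_def)
  have B: "B > 0"
    using q pos by (simp add: B_def)
  define K where "K = q + \<gamma> * (L - m) + B"
  have K: "K > 0"
    unfolding K_def using q pos B assms(2) by (intro add_pos_pos mult_pos_pos) auto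
  \<comment> \<open>The summand 1 covers \<open>t = 0\<close>; the division by \<open>\<rho>\<close>
    compensates for the decay of \<open>V\<close> starting only at index 1.\<close>
  define C where "C = 1 + sqrt ((K\<^sup>2 + c) / c) / \<rho>"
  have "C \<ge> 1"
    using c rho by (simp add: C_def)
  show thesis
  proof
    show "C > 0" using \<open>C \<ge> 1\<close> by simp
  next
    fix f :: "real ^ 'n \<Rightarrow> nat \<Rightarrow> real" and xs x0 x1 t
    assume f: "cost_fun m L f xs"
    define x where "x = iterates \<alpha> \<gamma> f x0 x1"
    define e where "e t = x t - xs t" for t
    define g where "g t = grad (\<lambda>y. f y t) (x t)" for t
    define y where "y t = L *\<^sub>R e t - g t" for t
    \<comment> \<open>\<open>p t\<close> stores what the next error needs from the previous step.
      Truncated subtraction gives \<open>p 0 = p 1\<close>, but only indices from 1 on are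
      used.\<close>
    define p where "p t = q *\<^sub>R e (t - 1) - \<gamma> *\<^sub>R y (t - 1)" for t
    define V where "V e p = q * (e \<bullet> e) + 2 * (\<alpha> * q / \<gamma>) * (e \<bullet> p) + p \<bullet> p" for e p :: "real ^ 'n"
    define M where "M = norm (x0 - xs 0) + norm (x1 - xs 1)"
    obtain a where a: "\<And>t. xs t = xs 0 + real t *\<^sub>R a"
      using f unfolding cost_fun_def by blast
    \<comment> \<open>Constant velocity means zero second difference, so the optimal point drops out
      of the error recursion.\<close>
    have xs: "xs (Suc (Suc t)) = 2 *\<^sub>R xs (Suc t) - xs t" for t
      unfolding a[of "Suc (Suc t)"] a[of "Suc t"] a[of t] by (simp add: vec_eq_iff algebra_simps)
    have sector: "y t \<bullet> ((L - m) *\<^sub>R e t - y t) \<ge> 0" for t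
    proof -
      have "(m *\<^sub>R e t - g t) \<bullet> (L *\<^sub>R e t - g t) \<le> 0"
        using f unfolding cost_fun_def e_def g_def by blast
      moreover have eq: "(L - m) *\<^sub>R e t - y t = - (m *\<^sub>R e t - g t)"
        by (simp add: y_def algebra_simps)
      ultimately show ?thesis
        unfolding eq unfolding inner_minus_right y_def by (simp only: inner_commute neg_0_le_iff_le)
    qed
    have "norm (y t) \<le> (L - m) * norm (e t)" for t
    proof (cases "y t = 0")
      case False
      have "norm (y t) * norm (y t) \<le> (L - m) * (y t \<bullet> e t)"
        using sector[of t] by (simp add: inner_diff_right flip: norm_eq_sqrt_inner power2_norm_eq_inner power2_eq_square)
      also have "\<dots> \<le> (L - m) * (norm (y t) * norm (e t))"
        using assms(2) by (intro mult_left_mono norm_cauchy_schwarz) auto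
      finally show ?thesis
        using False by (simp add: mult.left_commute)
    qed (use assms(2) in auto)
    note y_le = this
    \<comment> \<open>After substituting \<open>g = L e - y\<close>, the first equation cancels
      \<open>2 e (Suc t)\<close> and the second leaves \<open>q e t\<close>; the third matches the
      sector product of \<open>lyapunov_identity\<close> with \<open>sector\<close>.\<close>
    have coeffs: "\<alpha> * L = 2" "\<gamma> * L = 1 + q" "2 * q / \<gamma> = L - m"
      using assms(1,2) by (auto simp: \<alpha>_def \<gamma>_def q_def field_simps)
    have e_Suc: "e (Suc (Suc t)) = p (Suc t) + \<alpha> *\<^sub>R y (Suc t)" for t
    proof -
      have "e (Suc (Suc t)) = 2 *\<^sub>R e (Suc t) - e t - \<alpha> *\<^sub>R g (Suc t) + \<gamma> *\<^sub>R g t"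
        by (simp add: e_def x_def g_def xs algebra_simps scaleR_2)
      moreover have "g t = L *\<^sub>R e t - y t" for t
        by (simp add: y_def)
      ultimately show ?thesis
        by (simp add: p_def scaleR_diff_right coeffs scaleR_add_left)
    qed
    have p_Suc: "p (Suc (Suc t)) = q *\<^sub>R e (Suc t) - \<gamma> *\<^sub>R y (Suc t)" for t
      by (simp add: p_def)
    have V_Suc: "V (e (Suc (Suc t))) (p (Suc (Suc t))) \<le> q * V (e (Suc t)) (p (Suc t))" for t
    proof -
      have "V (e (Suc (Suc t))) (p (Suc (Suc t))) = q * V (e (Suc t)) (p (Suc t)) -
          (\<gamma>\<^sup>2 - q * \<alpha>\<^sup>2) * (y (Suc t) \<bullet> ((L - m) *\<^sub>R e (Suc t) - y (Suc t)))"
        unfolding e_Suc p_Suc V_def coeffs(3)[symmetric]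
        by (rule lyapunov_identity) (use pos in simp)
      then show ?thesis
        using lam sector[of "Suc t"] by simp
    qed
    have V_le: "V (e (Suc t)) (p (Suc t)) \<le> q ^ t * V (e 1) (p 1)" for t
    proof (induction t)
      case (Suc t)
      have "q * V (e (Suc t)) (p (Suc t)) \<le> q * (q ^ t * V (e 1) (p 1))"
        using Suc q by (intro mult_left_mono) auto
      then show ?case
        using V_Suc[of t] by simp
    qed simp
    \<comment> \<open>Completing the square in \<open>v\<close> shows that \<open>V\<close> is
      positive definite.\<close>
    have V_eq: "V u v = (norm (v + B *\<^sub>R u))\<^sup>2 + c * (norm u)\<^sup>2" for u v
      unfolding V_def c_def power2_norm_eq_inner B_def[symmetric]
      by (simp add: inner_add_left inner_add_right inner_commute[of v u] algebra_simps power2_eq_square)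
    have M: "norm (e 0) \<le> M" "norm (e 1) \<le> M" "M \<ge> 0"
      by (auto simp: e_def x_def M_def)
    have "norm (p 1 + B *\<^sub>R e 1) \<le> K * M"
    proof -
      have "norm (p 1 + B *\<^sub>R e 1) \<le> q * norm (e 0) + \<gamma> * norm (y 0) + B * norm (e 1)"
        unfolding p_def using q pos B
        by (intro order_trans[OF norm_triangle_ineq] add_mono order_trans[OF norm_triangle_ineq4]) auto
      also have "\<dots> \<le> q * M + \<gamma> * ((L - m) * M) + B * M"
        using M q pos B assms(2) order_trans[OF y_le[of 0]]
        by (intro add_mono mult_left_mono) (auto intro: mult_left_mono)
      finally show ?thesis
        by (simp add: K_def algebra_simps)
    qed
    then have V1: "V (e 1) (p 1) \<le> (K\<^sup>2 + c) * M\<^sup>2"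
      unfolding V_eq distrib_right power_mult_distrib[symmetric]
      using M c by (intro add_mono power_mono mult_left_mono) auto
    have "norm (e t) \<le> C * M * \<rho> ^ t"
    proof (cases t)
      case 0
      then show ?thesis
        using M \<open>C \<ge> 1\<close> mult_right_mono[of 1 C M] by simp
    next
      case (Suc s)
      have "c * (norm (e t))\<^sup>2 \<le> V (e t) (p t)"
        by (simp add: V_eq)
      also have "\<dots> \<le> q ^ s * ((K\<^sup>2 + c) * M\<^sup>2)"
        unfolding Suc using q by (intro order_trans[OF V_le] mult_left_mono V1) auto
      finally have "(norm (e t))\<^sup>2 \<le> (K\<^sup>2 + c) / c * M\<^sup>2 * (\<rho> ^ s)\<^sup>2"
        using c by (simp add: field_simps flip: rho(2) power_mult)
      also have "\<dots> = (sqrt ((K\<^sup>2 + c) / c) * M * \<rho> ^ s)\<^sup>2"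
        using c by (simp add: power_mult_distrib)
      finally have "norm (e t) \<le> sqrt ((K\<^sup>2 + c) / c) * M * \<rho> ^ s"
        by (rule power2_le_imp_le) (use c M rho in auto)
      also have "\<dots> = (sqrt ((K\<^sup>2 + c) / c) / \<rho>) * M * \<rho> ^ t"
        using rho by (simp add: Suc)
      also have "\<dots> \<le> C * M * \<rho> ^ t"
        using M rho by (intro mult_right_mono) (auto simp: C_def)
      finally show ?thesis .
    qed
    then show "norm (iterates \<alpha> \<gamma> f x0 x1 t - xs t) \<le>
        C * (norm (x0 - xs 0) + norm (x1 - xs 1)) * \<rho> ^ t"
      by (simp add: e_def x_def M_def)
  qed
qed

text \<open>Each initial error below \<open>\<sigma> / (2 * C)\<close> contributes less than half of
  \<sigma>, which gives stability. For the rate, the \<open>t\<close>-th root of the constant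
  prefactor tends to 1.\<close>

lemma geometric_decay_convergence:
  fixes \<alpha> \<gamma> m L \<rho> C :: real
  assumes C: "0 < C" and rho: "0 < \<rho>" "\<rho> < 1"
    and decay: "\<And>(f :: real ^ 'n \<Rightarrow> nat \<Rightarrow> real) xs x0 x1 t. cost_fun m L f xs \<Longrightarrow>
       norm (iterates \<alpha> \<gamma> f x0 x1 t - xs t) \<le> C * (norm (x0 - xs 0) + norm (x1 - xs 1)) * \<rho> ^ t"
  shows "globally_asymptotically_convergent TYPE('n::finite) \<alpha> \<gamma> m L"
    and "convergence_rate TYPE('n) \<alpha> \<gamma> m L \<le> ereal \<rho>"
proof -
  show "globally_asymptotically_convergent TYPE('n) \<alpha> \<gamma> m L"
    unfolding globally_asymptotically_convergent_def
  proof (intro allI impI conjI)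
    fix f :: "real ^ 'n \<Rightarrow> nat \<Rightarrow> real" and xs and \<sigma> :: real
    assume f: "cost_fun m L f xs" and "0 < \<sigma>"
    have "norm (iterates \<alpha> \<gamma> f x0 x1 t - xs t) < \<sigma>"
      if "norm (x0 - xs 0) < \<sigma> / (2 * C)" "norm (x1 - xs 1) < \<sigma> / (2 * C)" for x0 x1 t
    proof -
      have "norm (iterates \<alpha> \<gamma> f x0 x1 t - xs t) \<le> C * (norm (x0 - xs 0) + norm (x1 - xs 1)) * \<rho> ^ t"
        by (rule decay[OF f])
      also have "\<dots> \<le> C * (norm (x0 - xs 0) + norm (x1 - xs 1)) * 1"
        using C rho by (intro mult_left_mono) (auto simp: power_le_one)
      also have "\<dots> < \<sigma>"
        using that C by (simp add: field_simps)
      finally show ?thesis .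
    qed
    then show "\<exists>\<delta>>0. \<forall>x0 x1. norm (x0 - xs 0) < \<delta> \<and> norm (x1 - xs 1) < \<delta> \<longrightarrow>
        (\<forall>t\<ge>2. norm (iterates \<alpha> \<gamma> f x0 x1 t - xs t) < \<sigma>)"
      using C \<open>0 < \<sigma>\<close> by (intro exI[of _ "\<sigma> / (2 * C)"]) auto
  next
    fix f :: "real ^ 'n \<Rightarrow> nat \<Rightarrow> real" and xs x0 x1
    assume f: "cost_fun m L f xs"
    have "(\<lambda>t. C * (norm (x0 - xs 0) + norm (x1 - xs 1)) * \<rho> ^ t) \<longlonglongrightarrow> 0"
      using rho by (intro tendsto_mult_right_zero LIMSEQ_power_zero) auto
    then show "(\<lambda>t. iterates \<alpha> \<gamma> f x0 x1 t - xs t) \<longlonglongrightarrow> 0"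
      by (rule Lim_null_comparison[rotated]) (use decay[OF f] in auto)
  qed
  show "convergence_rate TYPE('n) \<alpha> \<gamma> m L \<le> ereal \<rho>"
    unfolding convergence_rate_def
  proof (rule Sup_least, clarify)
    fix f :: "real ^ 'n \<Rightarrow> nat \<Rightarrow> real" and xs x0 x1
    assume f: "cost_fun m L f xs"
    \<comment> \<open>The added 1 keeps \<open>E\<close> positive even when both starts are optimal,
      so that \<open>root t E\<close> tends to 1.\<close>
    define E where "E = 1 + C * (norm (x0 - xs 0) + norm (x1 - xs 1))"
    have E: "E > 0"
      using C by (auto simp: E_def intro!: add_pos_nonneg)
    have "\<forall>\<^sub>F t in sequentially. ereal (root t (norm (iterates \<alpha> \<gamma> f x0 x1 t - xs t))) \<le> ereal (root t E * \<rho>)"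
      using eventually_gt_at_top[of 0]
    proof eventually_elim
      case (elim t)
      have "norm (iterates \<alpha> \<gamma> f x0 x1 t - xs t) \<le> E * \<rho> ^ t"
        using decay[OF f, of x0 x1 t] rho by (simp add: E_def distrib_right add_increasing)
      then have "root t (norm (iterates \<alpha> \<gamma> f x0 x1 t - xs t)) \<le> root t (E * \<rho> ^ t)"
        using elim by simp
      also have "\<dots> = root t E * \<rho>"
        using elim rho by (simp add: real_root_mult real_root_power_cancel)
      finally show ?case by simp
    qed
    then have "limsup (\<lambda>t. ereal (root t (norm (iterates \<alpha> \<gamma> f x0 x1 t - xs t)))) \<le>
        limsup (\<lambda>t. ereal (root t E * \<rho>))"
      by (rule Limsup_mono)
    also have "\<dots> = ereal \<rho>"
      using tendsto_mult[OF LIMSEQ_root_const[OF E] tendsto_const[of \<rho>]]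
      by (intro lim_imp_Limsup) auto
    finally show "limsup (\<lambda>t. ereal (root t (norm (iterates \<alpha> \<gamma> f x0 x1 t - xs t)))) \<le> ereal \<rho>" .
  qed
qed

theorem theorem1:
  fixes m L \<kappa> :: real
  assumes "0 < m" and "m < L" and "\<kappa> = L / m"
  shows "(\<exists>\<alpha> \<gamma>. convergent_via_circle_criterion \<alpha> \<gamma> m L \<and>
            globally_asymptotically_convergent TYPE('n::finite) \<alpha> \<gamma> m L \<and>
            convergence_rate TYPE('n) \<alpha> \<gamma> m L = ereal (sqrt ((\<kappa> - 1) / (\<kappa> + 1))) \<and>
            \<alpha> = 2 / (m * \<kappa>) \<and> \<gamma> = 2 / (m * (\<kappa> + 1))) \<and>
         (\<forall>\<alpha> \<gamma>. convergent_via_circle_criterion \<alpha> \<gamma> m L \<longrightarrow>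
            convergence_rate TYPE('n) \<alpha> \<gamma> m L \<ge> ereal (sqrt ((\<kappa> - 1) / (\<kappa> + 1))))"
proof -
  have k: "(\<kappa> - 1) / (\<kappa> + 1) = (L - m) / (L + m)" "m * \<kappa> = L" "m * (\<kappa> + 1) = L + m"
    using assms by (auto simp: field_simps)
  obtain C where C: "C > 0"
    "\<And>(f :: real ^ 'n \<Rightarrow> nat \<Rightarrow> real) xs x0 x1 t. cost_fun m L f xs \<Longrightarrow>
       norm (iterates (2 / L) (2 / (L + m)) f x0 x1 t - xs t) \<le>
       C * (norm (x0 - xs 0) + norm (x1 - xs 1)) * sqrt ((L - m) / (L + m)) ^ t"
    using optimal_parameters_decay[OF assms(1,2), where ?'n = 'n] by blast
  have rho: "0 < sqrt ((L - m) / (L + m))" "sqrt ((L - m) / (L + m)) < 1"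
    using assms(1,2) by auto
  note conv = geometric_decay_convergence[OF C(1) rho C(2)]
  show ?thesis
    unfolding k
    \<comment> \<open>Equality of the rate comes from the decay bound above and the general lower
      bound, taken at the optimal parameters, below.\<close>
    using optimal_parameters_circle_criterion[OF assms(1,2)] conv
      convergence_rate_ge[OF assms(1,2), where ?'n = 'n]
    by (auto intro: antisym)
qed

end
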